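(* Let $G$ be a graph on the vertex set $V=\{v_1,\dots,v_n\}$ with at least one edge (i.e. $G$ is non-empty). The following statements are equivalent: (i) $G$ is a global amoeba; (ii) for each $x\in[n]$ there is some $y\in S_Gx$ with $\deg_G(v_y)=1$; (iii) $G\cup K_1$ is a local amoeba.
   Context: All graphs are finite and simple; $[n]=\{1,\dots,n\}$ and $S_n$ is the symmetric group on $[n]$, with composition $\sigma\rho=\sigma\circ\rho$. For a graph $G$ on vertex set $V=\{v_1,\dots,v_n\}$ let $L_G=\{ij : v_iv_j\in E(G)\}$ (unordered pairs). For $\sigma\in S_n$, $G_\sigma$ denotes the graph on $V$ with $E(G_\sigma)=\{v_{\sigma^{-1}(i)}v_{\sigma^{-1}(j)} : ij\in L_G\}$. For $e\in E(G)$ and $e'\in E(\overline G)\cup\{e\}$, the edge-replacement $e\to e'$ produces $G-e+e'$; it is feasible if $G-e+e'\cong G$. Let $R_G=\{rs\to kl : G-v_rv_s+v_kv_l\cong G\}$ be the set of feasible edge-replacements (written via labels), and for $rs\to kl\in R_G$ let $S_G(rs\to kl)=\{\sigma\in S_n : G_\sigma=G-v_rv_s+v_kv_l\}$. Let $\mathcal E_G=\bigcup_{rs\to kl\in R_G}S_G(rs\to kl)$ and $S_G=\langle\mathcal E_G\rangle\le S_n$. For $x\in[n]$, $S_Gx=\{\sigma(x):\sigma\in S_G\}$ is the orbit of $x$. A graph $G$ of order $n$ is a local amoeba if $S_G=S_n$. A graph $G$ is a global amoeba if there is an integer $T\ge 0$ such that $G\cup tK_1$ (the disjoint union of $G$ with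 $t$ isolated vertices, labeled $v_{n+1},\dots,v_{n+t}$) is a local amoeba for all $t\ge T$. *)

theory Defs
  imports "HOL-Algebra.Sym_Groups" "HOL-Algebra.Generated_Groups"
begin

section \<open>Finite simple graphs\<close>

record 'a ugraph =
  vertices :: "'a set"
  edges :: "'a set set"

definition simple_graph :: "'a ugraph \<Rightarrow> bool" where
  "simple_graph G \<longleftrightarrow>
     finite (vertices G) \<and> (\<forall>e \<in> edges G. e \<subseteq> vertices G \<and> card e = 2)"

definition degree :: "'a ugraph \<Rightarrow> 'a \<Rightarrow> nat" where
  "degree G u = card {e \<in> edges G. u \<in> e}"

definition graph_complement :: "'a ugraph \<Rightarrow> 'a ugraph" where
  "graph_complement G =
     \<lparr> vertices = vertices G,
       edges = {{u, w} | u w. u \<in> vertices G \<and> w \<in> vertices G \<and> u \<noteq> w} - edges G \<rparr>"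

definition graph_iso :: "'a ugraph \<Rightarrow> 'b ugraph \<Rightarrow> bool" where
  "graph_iso G H \<longleftrightarrow>
     (\<exists>f. bij_betw f (vertices G) (vertices H) \<and>
          (\<forall>u \<in> vertices G. \<forall>w \<in> vertices G. {u, w} \<in> edges G \<longleftrightarrow> {f u, f w} \<in> edges H))"

definition disjoint_union :: "'a ugraph \<Rightarrow> 'b ugraph \<Rightarrow> ('a + 'b) ugraph" where
  "disjoint_union G H =
     \<lparr> vertices = vertices G <+> vertices H,
       edges = ((`) Inl) ` edges G \<union> ((`) Inr) ` edges H \<rparr>"

definition edgeless_graph :: "'a set \<Rightarrow> 'a ugraph" where
  "edgeless_graph A = \<lparr> vertices = A, edges = {} \<rparr>"

text \<open>The graph G - e + e'.\<close>

definition edge_replace :: "'a ugraph \<Rightarrow> 'a set \<Rightarrow> 'a set \<Rightarrow> 'a ugraph" where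
  "edge_replace G e e' = \<lparr> vertices = vertices G, edges = insert e' (edges G - {e}) \<rparr>"

section \<open>Labelled graphs\<close>

text \<open>
  The enumeration of the vertex set as \<open>{v\<^sub>1, \<dots>, v\<^sub>n}\<close> is a function \<open>v\<close>, relevant only on
  \<open>{1..n}\<close>, where n is the order of the graph.  Unordered pairs ij of labels are sets \<open>{i, j}\<close>,
  so that the vertex pair named by a pair \<open>a\<close> of labels is \<open>v ` a\<close>.
\<close>

definition labelling :: "'a ugraph \<Rightarrow> (nat \<Rightarrow> 'a) \<Rightarrow> bool" where
  "labelling G v \<longleftrightarrow> bij_betw v {1..card (vertices G)} (vertices G)"

definition label_edges :: "'a ugraph \<Rightarrow> (nat \<Rightarrow> 'a) \<Rightarrow> nat set set" where
  "label_edges G v =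
     {{i, j} | i j. i \<in> {1..card (vertices G)} \<and> j \<in> {1..card (vertices G)} \<and>
                    {v i, v j} \<in> edges G}"

text \<open>The graph \<open>G\<^sub>\<sigma>\<close>.\<close>

definition relabel :: "'a ugraph \<Rightarrow> (nat \<Rightarrow> 'a) \<Rightarrow> (nat \<Rightarrow> nat) \<Rightarrow> 'a ugraph" where
  "relabel G v \<sigma> =
     \<lparr> vertices = vertices G,
       edges = {{v (inv' \<sigma> i), v (inv' \<sigma> j)} | i j. {i, j} \<in> label_edges G v} \<rparr>"

text \<open>
  \<open>R\<^sub>G\<close>: the element (a, b) stands for the replacement of the edge labelled a by the pair labelled
  b.  The trivial replacements (a, a) are included.
\<close>

definition feasible_replacements ::
    "'a ugraph \<Rightarrow> (nat \<Rightarrow> 'a) \<Rightarrow> (nat set \<times> nat set) set" where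
  "feasible_replacements G v =
     {(a, b). a \<in> label_edges G v \<and>
              b \<in> label_edges (graph_complement G) v \<union> {a} \<and>
              graph_iso (edge_replace G (v ` a) (v ` b)) G}"

text \<open>\<open>S\<^sub>G(a \<rightarrow> b)\<close>.\<close>

definition replacement_perms ::
    "'a ugraph \<Rightarrow> (nat \<Rightarrow> 'a) \<Rightarrow> nat set \<Rightarrow> nat set \<Rightarrow> (nat \<Rightarrow> nat) set" where
  "replacement_perms G v a b =
     {\<sigma> \<in> carrier (sym_group (card (vertices G))).
        relabel G v \<sigma> = edge_replace G (v ` a) (v ` b)}"

text \<open>\<open>\<E>\<^sub>G\<close> and the group \<open>S\<^sub>G\<close> it generates in the symmetric group.\<close>

definition all_replacement_perms :: "'a ugraph \<Rightarrow> (nat \<Rightarrow> 'a) \<Rightarrow> (nat \<Rightarrow> nat) set" where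
  "all_replacement_perms G v =
     (\<Union>(a, b) \<in> feasible_replacements G v. replacement_perms G v a b)"

definition amoeba_group :: "'a ugraph \<Rightarrow> (nat \<Rightarrow> 'a) \<Rightarrow> (nat \<Rightarrow> nat) set" where
  "amoeba_group G v = generate (sym_group (card (vertices G))) (all_replacement_perms G v)"

definition amoeba_orbit :: "'a ugraph \<Rightarrow> (nat \<Rightarrow> 'a) \<Rightarrow> nat \<Rightarrow> nat set" where
  "amoeba_orbit G v x = {\<sigma> x | \<sigma>. \<sigma> \<in> amoeba_group G v}"

section \<open>Amoebas\<close>

definition local_amoeba :: "'a ugraph \<Rightarrow> (nat \<Rightarrow> 'a) \<Rightarrow> bool" where
  "local_amoeba G v \<longleftrightarrow> amoeba_group G v = carrier (sym_group (card (vertices G)))"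

text \<open>
  The disjoint union of G with t isolated vertices.  The new vertices are \<open>Inr (n + 1)\<close>, \dots,
  \<open>Inr (n + t)\<close>, and carry the labels n + 1, \dots, n + t.
\<close>

definition add_isolated :: "'a ugraph \<Rightarrow> nat \<Rightarrow> ('a + nat) ugraph" where
  "add_isolated G t =
     disjoint_union G (edgeless_graph {card (vertices G) + 1..card (vertices G) + t})"

definition extend_labelling :: "'a ugraph \<Rightarrow> (nat \<Rightarrow> 'a) \<Rightarrow> nat \<Rightarrow> 'a + nat" where
  "extend_labelling G v i = (if i \<le> card (vertices G) then Inl (v i) else Inr i)"

definition global_amoeba :: "'a ugraph \<Rightarrow> (nat \<Rightarrow> 'a) \<Rightarrow> bool" where
  "global_amoeba G v \<longleftrightarrow>
     (\<exists>T. \<forall>t \<ge> T. local_amoeba (add_isolated G t) (extend_labelling G v))"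

lemma simple_graph_add_isolated: "simple_graph G \<Longrightarrow> simple_graph (add_isolated G t)"
  by (auto simp: simple_graph_def add_isolated_def disjoint_union_def edgeless_graph_def card_image)

lemma card_vertices_add_isolated:
  "simple_graph G \<Longrightarrow> card (vertices (add_isolated G t)) = card (vertices G) + t"
  by (simp add: simple_graph_def add_isolated_def disjoint_union_def edgeless_graph_def card_Plus)

lemma labelling_extend_labelling:
  assumes "simple_graph G" "labelling G v"
  shows "labelling (add_isolated G t) (extend_labelling G v)"
proof -
  let ?n = "card (vertices G)"
  have "bij_betw (\<lambda>i. Inl (v i) :: 'a + nat) {1..?n} (Inl ` vertices G)"
    using bij_betw_trans[OF assms(2)[unfolded labelling_def], of Inl "Inl ` vertices G"]
    by (simp add: inj_on_imp_bij_betw comp_def)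
  then have "bij_betw (extend_labelling G v) {1..?n} (Inl ` vertices G)"
    by (subst bij_betw_cong[where g = "\<lambda>i. Inl (v i)"]) (simp_all add: extend_labelling_def)
  moreover have "bij_betw (extend_labelling G v) {?n + 1..?n + t} (Inr ` {?n + 1..?n + t})"
    by (subst bij_betw_cong[where g = Inr])
      (simp_all only: extend_labelling_def atLeastAtMost_iff, simp_all add: inj_on_imp_bij_betw)
  ultimately have "bij_betw (extend_labelling G v) ({1..?n} \<union> {?n + 1..?n + t})
      (Inl ` vertices G \<union> Inr ` {?n + 1..?n + t})"
    by (rule bij_betw_combine) blast
  moreover have "{1..?n} \<union> {?n + 1..?n + t} = {1..?n + t}"
    by auto
  ultimately show ?thesis
    using assms(1) unfolding labelling_def
    by (simp add: card_vertices_add_isolated)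
      (simp add: add_isolated_def disjoint_union_def edgeless_graph_def Plus_def)
qed

end

theory Submission
  imports Defs
begin

text \<open>
  In terms of the set \<open>L\<close> of label pairs, \<open>\<E>\<^sub>G\<close> consists of the permutations \<open>\<sigma>\<close> with
  \<open>|\<sigma>(L) - L| \<le> 1\<close>, which makes it visibly closed under inverses and under composition with
  automorphisms.

  If \<open>y\<close> is a leaf and \<open>c\<close> is isolated, then the transposition \<open>(y c)\<close> lies in \<open>\<E>\<^sub>G\<close>.
  Conjugating by elements of \<open>S\<^sub>G\<close> that move \<open>x\<close> to a leaf gives all transpositions \<open>(x c)\<close>, and
  these generate the symmetric group.

  For the converse let \<open>\<sigma>\<close> be such a permutation for \<open>G \<union> tK\<^sub>1\<close>.  Any permutation of \<open>[n]\<close> that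
  agrees with \<open>\<sigma>\<close> at the points of \<open>[n]\<close> not leaving \<open>[n]\<close> lies in \<open>\<E>\<^sub>G\<close>, because an edge mapped
  to an edge by \<open>\<sigma>\<close> stays inside \<open>[n]\<close>.  Moreover \<open>\<sigma>\<close> lowers degrees by at most one.  Hence a
  vertex of positive degree whose orbit under \<open>S\<^sub>G\<close> contains no leaf cannot become isolated under the
  larger group, and if an isolated vertex has no leaf in its orbit then no isolated vertex can
  become non-isolated.  Both are impossible if that group is the full symmetric group.
\<close>

section \<open>Permutations\<close>

text \<open>\<open>A\<close> and its image have complements in \<open>S\<close> of equal finite
  size, so any bijection between these completes \<open>f\<close>.\<close>

lemma permutes_extend:
  assumes "finite S" "A \<subseteq> S" "inj_on f A" "f ` A \<subseteq> S"
  obtains p where "p permutes S" "\<And>x. x \<in> A \<Longrightarrow> p x = f x"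
proof -
  have fin: "finite A" using assms finite_subset by blast
  have "card (S - A) = card (S - f ` A)"
    using assms fin by (simp add: card_Diff_subset card_image)
  then obtain g where g: "bij_betw g (S - A) (S - f ` A)"
    using assms(1) finite_same_card_bij by blast
  define p where "p x = (if x \<in> A then f x else if x \<in> S then g x else x)" for x
  have "bij_betw p A (f ` A)"
    using assms(3) by (simp add: bij_betw_def p_def inj_on_def)
  moreover have "bij_betw p (S - A) (S - f ` A)"
    using g by (rule bij_betw_cong[THEN iffD1, rotated]) (simp add: p_def)
  ultimately have "bij_betw p (A \<union> (S - A)) (f ` A \<union> (S - f ` A))"
    by (rule bij_betw_combine) blast
  then have "bij_betw p S S"
    using assms(2,4) by (simp add: Un_absorb1)
  then have "p permutes S"
    by (rule bij_imp_permutes) (use assms(2) in \<open>auto simp: p_def\<close>)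
  then show thesis
    by (rule that) (simp add: p_def)
qed

text \<open>Transpositions generate all permutations of a finite set, and (a b) = (a c)(b c)(a c)
  reduces them to those through the centre \<open>c\<close>.\<close>

lemma permutes_in_star_closure:
  assumes "p permutes S" "finite S" "c \<in> S" "id \<in> K"
    and comp: "\<And>f g. f \<in> K \<Longrightarrow> g \<in> K \<Longrightarrow> f \<circ> g \<in> K"
    and star: "\<And>x. x \<in> S \<Longrightarrow> transpose x c \<in> K"
  shows "p \<in> K"
  using assms(1,2)
proof (induction rule: permutes_induct)
  case id
  show ?case by fact
next
  case (swap a b p)
  have "transpose a b \<in> K"
  proof (cases "b = c")
    case True
    with star swap show ?thesis by simp
  next
    case False
    then have "transpose a b = transpose a c \<circ> transpose b c \<circ> transpose a c"
      using transpose_comp_triple[of a b c] swap(3) by (simp add: transpose_commute)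
    with star comp swap show ?thesis by metis
  qed
  with comp swap show ?case by blast
qed

section \<open>Near-automorphisms of a set of label pairs\<close>

text \<open>Since the image of a finite \<open>L\<close> has as many pairs as \<open>L\<close>, the
  bound allows exactly two cases: value 0 is an automorphism, value 1 exchanges one pair for
  another.\<close>

definition near_auts :: "nat \<Rightarrow> nat set set \<Rightarrow> (nat \<Rightarrow> nat) set" where
  "near_auts m L = {\<sigma>. \<sigma> permutes {1..m} \<and> card ((`) \<sigma> ` L - L) \<le> 1}"

definition near_aut_group :: "nat \<Rightarrow> nat set set \<Rightarrow> (nat \<Rightarrow> nat) set" where
  "near_aut_group m L = generate (sym_group m) (near_auts m L)"

definition pair_degree :: "nat set set \<Rightarrow> nat \<Rightarrow> nat" where
  "pair_degree L x = card {e \<in> L. x \<in> e}"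

lemma near_aut_group_id: "id \<in> near_aut_group m L"
  unfolding near_aut_group_def using generate.one[of "sym_group m"] by (simp add: sym_group_one)

lemma near_aut_group_comp:
  "\<sigma> \<in> near_aut_group m L \<Longrightarrow> \<tau> \<in> near_aut_group m L \<Longrightarrow> \<sigma> \<circ> \<tau> \<in> near_aut_group m L"
  unfolding near_aut_group_def using generate.eng[of \<sigma> "sym_group m"] by (simp add: sym_group_mult)

lemma near_auts_in_group: "\<sigma> \<in> near_auts m L \<Longrightarrow> \<sigma> \<in> near_aut_group m L"
  unfolding near_aut_group_def by (rule generate.incl)

lemma near_auts_carrier: "near_auts m L \<subseteq> carrier (sym_group m)"
  by (auto simp: near_auts_def sym_group_carrier)

lemma near_aut_group_permutes: "\<sigma> \<in> near_aut_group m L \<Longrightarrow> \<sigma> permutes {1..m}"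
  using group.generate_in_carrier[OF sym_group_is_group near_auts_carrier]
  by (auto simp: near_aut_group_def sym_group_carrier)

lemma near_aut_group_inv: "\<sigma> \<in> near_aut_group m L \<Longrightarrow> inv' \<sigma> \<in> near_aut_group m L"
  using group.generate_m_inv_closed[OF sym_group_is_group near_auts_carrier, of \<sigma> m L]
    near_aut_group_permutes[of \<sigma> m L]
  by (simp add: near_aut_group_def sym_group_carrier)

text \<open>The pairs live on \<open>{1..n}\<close>, while the groups act on \<open>{1..m}\<close>
  for varying \<open>m\<close>: adding isolated vertices changes \<open>m\<close> and leaves
  \<open>L\<close> alone.\<close>

locale label_pairs =
  fixes n :: nat and L :: "nat set set"
  assumes pair: "e \<in> L \<Longrightarrow> e \<subseteq> {1..n} \<and> card e = 2"
begin

lemma finite_pairs: "finite L"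
  using pair finite_subset[of L "Pow {1..n}"] by auto

lemma card_image_pairs: "\<sigma> permutes S \<Longrightarrow> card ((`) \<sigma> ` L) = card L"
  by (rule card_image) (meson inj_image_eq_iff inj_on_def permutes_inj)

lemma pair_degree_eq_0: "pair_degree L x = 0 \<longleftrightarrow> (\<forall>e\<in>L. x \<notin> e)"
  unfolding pair_degree_def using finite_pairs by auto

lemma pair_degree_outside: "x \<notin> {1..n} \<Longrightarrow> pair_degree L x = 0"
  unfolding pair_degree_eq_0 using pair by blast

lemma image_inv_image_diff:
  assumes "\<sigma> permutes S"
  shows "(`) \<sigma> ` ((`) (inv' \<sigma>) ` L - A) = L - (`) \<sigma> ` A"
proof -
  have "inj ((`) \<sigma>)"
    using assms by (meson inj_image_eq_iff inj_on_def permutes_inj)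
  moreover have "(`) \<sigma> ` (`) (inv' \<sigma>) ` L = L"
    using assms by (simp add: image_image permutes_inverses)
  ultimately show ?thesis by (simp add: image_set_diff)
qed

text \<open>Applying \<open>\<sigma>\<close> to the left difference turns it into \<open>L\<close>
  minus the image of \<open>L\<close>; two finite sets of equal size have differences of equal
  size.\<close>

lemma card_diff_inv:
  assumes "\<sigma> permutes S"
  shows "card ((`) (inv' \<sigma>) ` L - L) = card ((`) \<sigma> ` L - L)"
proof -
  have "inj ((`) \<sigma>)"
    using assms by (meson inj_image_eq_iff inj_on_def permutes_inj)
  then have "card ((`) (inv' \<sigma>) ` L - L) = card (L - (`) \<sigma> ` L)"
    using image_inv_image_diff[OF assms, of L] card_image[of "(`) \<sigma>"] by (metis inj_on_subset subset_UNIV)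
  also have "\<dots> = card ((`) \<sigma> ` L - L)"
    using card_image_pairs[OF assms] finite_pairs
    by (metis card_le_sym_Diff finite_imageI le_antisym order_refl)
  finally show ?thesis .
qed

lemma near_auts_inv: "\<sigma> \<in> near_auts m L \<Longrightarrow> inv' \<sigma> \<in> near_auts m L"
  using card_diff_inv by (auto simp: near_auts_def permutes_inv)

lemma near_auts_mono:
  assumes "n \<le> m" shows "near_auts n L \<subseteq> near_auts m L"
  using assms permutes_subset[of _ "{1..n}" "{1..m}"] by (auto simp: near_auts_def)

lemma near_aut_group_mono:
  assumes "n \<le> m" shows "near_aut_group n L \<subseteq> near_aut_group m L"
proof
  fix \<sigma> assume "\<sigma> \<in> near_aut_group n L"
  then show "\<sigma> \<in> near_aut_group m L"
    unfolding near_aut_group_def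
  proof (induction rule: generate.induct)
    case one
    show ?case by (metis near_aut_group_id near_aut_group_def sym_group_one)
  next
    case (incl h)
    then show ?case using near_auts_mono[OF assms] by (blast intro: generate.incl)
  next
    case (inv h)
    \<comment> \<open>The inverse of a generator is itself a generator, so no inverse has to be
      transferred between the two groups.\<close>
    then have "h \<in> carrier (sym_group n)" "inv' h \<in> near_auts m L"
      using near_auts_carrier near_auts_inv near_auts_mono[OF assms] by blast+
    then show ?case by (simp add: generate.incl)
  next
    case (eng h1 h2)
    then show ?case by (metis generate.eng sym_group_mult)
  qed
qed

lemma label_if_pair_degree_pos: "pair_degree L x \<noteq> 0 \<Longrightarrow> x \<in> {1..n}"
  by (metis pair_degree_outside)

section \<open>Transpositions, degrees and restriction to the original labels\<close>

lemma transpose_isolated_image: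
  assumes "pair_degree L x = 0" "pair_degree L y = 0"
  shows "(`) (transpose x y) ` L = L"
proof -
  have "transpose x y ` e = e" if "e \<in> L" for e
    using assms that by (simp add: pair_degree_eq_0)
  then show ?thesis by simp
qed

text \<open>Every pair other than the single one at \<open>y\<close> avoids both \<open>y\<close>
  and \<open>c\<close> and stays fixed, so at most one image is new.\<close>

lemma transpose_leaf_isolated:
  assumes "pair_degree L y = 1" "pair_degree L c = 0" "y \<in> {1..m}" "c \<in> {1..m}"
  shows "transpose y c \<in> near_auts m L"
proof -
  obtain e where e: "{e \<in> L. y \<in> e} = {e}"
    using assms(1) unfolding pair_degree_def by (metis card_1_singletonE)
  have fixed: "transpose y c ` f = f" if "f \<in> L" "f \<noteq> e" for f
    using assms(2) that e by (intro transpose_image_eq) (auto simp: pair_degree_eq_0)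
  then have "(`) (transpose y c) ` L - L \<subseteq> {transpose y c ` e}"
  proof (intro subsetI)
    fix g assume "g \<in> (`) (transpose y c) ` L - L"
    then obtain f where "f \<in> L" "g = transpose y c ` f" "g \<notin> L" by blast
    with fixed show "g \<in> {transpose y c ` e}" by (cases "f = e") auto
  qed
  then have "card ((`) (transpose y c) ` L - L) \<le> 1"
    using card_mono by (metis card.empty card_insert_disjoint empty_iff finite.emptyI finite_insert One_nat_def)
  then show ?thesis
    using assms(3,4) by (simp add: near_auts_def permutes_swap_id)
qed

text \<open>The pairs at \<open>x\<close> are sent injectively to pairs at
  \<open>\<sigma> x\<close>, and at most one of these images falls outside \<open>L\<close>.\<close>

lemma pair_degree_near_aut_le:
  assumes "\<sigma> \<in> near_auts m L"
  shows "pair_degree L x \<le> Suc (pair_degree L (\<sigma> x))"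
proof -
  have inj: "inj_on ((`) \<sigma>) {e \<in> L. x \<in> e}"
    using assms by (auto simp: near_auts_def inj_on_def dest: permutes_inj inj_image_eq_iff)
  have "pair_degree L x = card ((`) \<sigma> ` {e \<in> L. x \<in> e})"
    by (simp add: pair_degree_def card_image inj)
  also have "\<dots> \<le> card ({e \<in> L. \<sigma> x \<in> e} \<union> ((`) \<sigma> ` L - L))"
    by (rule card_mono) (auto simp: finite_pairs)
  also have "\<dots> \<le> pair_degree L (\<sigma> x) + card ((`) \<sigma> ` L - L)"
    by (simp add: pair_degree_def card_Un_le)
  also have "\<dots> \<le> Suc (pair_degree L (\<sigma> x))"
    using assms by (simp add: near_auts_def)
  finally show ?thesis .
qed

lemma near_aut_restrict:
  assumes "\<sigma> \<in> near_auts m L"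
  obtains \<tau> where "\<tau> \<in> near_auts n L"
    and "\<And>x. x \<in> {1..n} \<Longrightarrow> \<sigma> x \<in> {1..n} \<Longrightarrow> \<tau> x = \<sigma> x"
proof -
  let ?A = "{x \<in> {1..n}. \<sigma> x \<in> {1..n}}"
  have inj: "inj \<sigma>" using assms permutes_inj by (auto simp: near_auts_def)
  obtain \<tau> where \<tau>: "\<tau> permutes {1..n}" "\<And>x. x \<in> ?A \<Longrightarrow> \<tau> x = \<sigma> x"
    by (rule permutes_extend[of "{1..n}" ?A \<sigma>]) (auto intro: inj_on_subset[OF inj])
  have inj\<tau>: "inj \<tau>" using \<tau>(1) permutes_inj by blast
  let ?D = "{e \<in> L. \<sigma> ` e \<notin> L}"
  \<comment> \<open>Both \<open>e\<close> and its image are pairs of \<open>L\<close>, hence inside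
    \<open>{1..n}\<close>, so \<open>e\<close> lies in \<open>?A\<close>. Thus only pairs in
    \<open>?D\<close> can have an image under \<open>\<tau>\<close> outside
    \<open>L\<close>.\<close>
  have agree: "\<tau> ` e = \<sigma> ` e" if "e \<in> L" "\<sigma> ` e \<in> L" for e
    using pair[OF that(1)] pair[OF that(2)] by (intro image_cong refl \<tau>(2)) auto
  have "card ((`) \<tau> ` L - L) \<le> card ((`) \<tau> ` ?D)"
    using agree by (intro card_mono) (auto simp: finite_pairs)
  also have "\<dots> \<le> card ?D"
    by (intro card_image_le) (simp add: finite_pairs)
  also have "\<dots> = card ((`) \<sigma> ` ?D)"
    using inj by (intro card_image[symmetric]) (auto simp: inj_on_def inj_image_eq_iff)
  also have "(`) \<sigma> ` ?D = (`) \<sigma> ` L - L"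
    by auto
  also have "card \<dots> \<le> 1" using assms by (simp add: near_auts_def)
  finally have "\<tau> \<in> near_auts n L" using \<tau>(1) by (simp add: near_auts_def)
  then show thesis using that \<tau>(2) by simp
qed

section \<open>Reaching leaves and generating the full symmetric group\<close>

definition leaf_reachable :: "nat \<Rightarrow> bool" where
  "leaf_reachable x \<longleftrightarrow> (\<exists>\<sigma> \<in> near_aut_group n L. pair_degree L (\<sigma> x) = 1)"

text \<open>Reachability refers to the group on \<open>{1..n}\<close>, whereas
  \<open>\<sigma>\<close> may move larger labels. The restricted permutation has the same effect on
  \<open>x\<close> and can be followed by one leading to a leaf.\<close>

lemma leaf_reachable_near_aut:
  assumes "\<sigma> \<in> near_auts m L" "x \<in> {1..n}" "\<sigma> x \<in> {1..n}" "leaf_reachable (\<sigma> x)"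
  shows "leaf_reachable x"
proof -
  obtain \<tau> where \<tau>: "\<tau> \<in> near_auts n L" "\<tau> x = \<sigma> x"
    using near_aut_restrict[OF assms(1)] assms(2,3) by metis
  obtain \<rho> where "\<rho> \<in> near_aut_group n L" "pair_degree L (\<rho> (\<sigma> x)) = 1"
    using assms(4) by (auto simp: leaf_reachable_def)
  with \<tau> near_aut_group_comp[of \<rho> n L \<tau>] near_auts_in_group show ?thesis
    unfolding leaf_reachable_def by (metis comp_apply)
qed

lemma leaf_imp_leaf_reachable: "pair_degree L x = 1 \<Longrightarrow> leaf_reachable x"
  unfolding leaf_reachable_def using near_aut_group_id by (metis id_apply)

text \<open>A property preserved by the generators is preserved by the group, and the full symmetric
  group is transitive. One direction of preservation suffices because the generating set is closed
  under inverses.\<close>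

lemma near_auts_invariant_full:
  assumes full: "near_aut_group m L = carrier (sym_group m)"
    and step: "\<And>\<sigma> x. \<sigma> \<in> near_auts m L \<Longrightarrow> x \<in> {1..m} \<Longrightarrow> P x \<Longrightarrow> P (\<sigma> x)"
    and "P x" "x \<in> {1..m}" "y \<in> {1..m}"
  shows "P y"
proof -
  have inv_group: "\<forall>z \<in> {1..m}. P z \<longrightarrow> P (\<sigma> z)" if "\<sigma> \<in> near_aut_group m L" for \<sigma>
    using that[unfolded near_aut_group_def]
  proof (induction rule: generate.induct)
    case one
    show ?case by (simp add: sym_group_one)
  next
    case (incl h)
    then show ?case using step by blast
  next
    case (inv h)
    then have "h \<in> carrier (sym_group m)" using near_auts_carrier by blast
    with inv show ?case using step near_auts_inv by simp
  next
    case (eng h1 h2)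
    have "h2 permutes {1..m}"
      using eng(2) near_aut_group_permutes by (simp add: near_aut_group_def)
    then have "h2 z \<in> {1..m}" if "z \<in> {1..m}" for z
      using that by (metis permutes_in_image)
    with eng show ?case by (simp add: sym_group_mult)
  qed
  have "transpose x y \<in> near_aut_group m L"
    using assms(4,5) by (simp add: full sym_group_carrier permutes_swap_id)
  with inv_group assms(3,4) show ?thesis by fastforce
qed

lemma leaf_reachable_if_full:
  assumes "n < m" and full: "near_aut_group m L = carrier (sym_group m)"
    and "L \<noteq> {}" "x \<in> {1..n}"
  shows "leaf_reachable x"
proof (rule ccontr)
  assume x: "\<not> leaf_reachable x"
  have pos: "leaf_reachable z" if z: "z \<in> {1..n}" "pair_degree L z \<noteq> 0" for z
  proof (rule ccontr)
    assume "\<not> leaf_reachable z"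
    let ?P = "\<lambda>w. \<not> leaf_reachable w \<and> pair_degree L w \<noteq> 0"
    \<comment> \<open>Since \<open>n < m\<close>, the label \<open>n + 1\<close> is acted upon, and
      it is isolated. Spreading \<open>?P\<close> from \<open>z\<close> to it is therefore
      absurd.\<close>
    have "?P (n + 1)"
    proof (rule near_auts_invariant_full[OF full, where P = ?P and x = z])
      fix \<sigma> w assume *: "\<sigma> \<in> near_auts m L" "?P w"
      \<comment> \<open>A nonzero degree other than 1 is at least 2 and stays positive after losing
        one. So \<open>\<sigma> w\<close> is still in \<open>{1..n}\<close>, and a leaf reachable
        from it would be reachable from \<open>w\<close>.\<close>
      then have "pair_degree L w \<noteq> 1" using leaf_imp_leaf_reachable by blast
      with * pair_degree_near_aut_le[OF *(1), of w] have "pair_degree L (\<sigma> w) \<noteq> 0" by linarith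
      moreover have "w \<in> {1..n}" using *(2) label_if_pair_degree_pos by simp
      moreover have "\<sigma> w \<in> {1..n}" using calculation(1) by (rule label_if_pair_degree_pos)
      ultimately show "?P (\<sigma> w)" using leaf_reachable_near_aut[OF *(1), of w] *(2) by blast
    qed (use \<open>\<not> leaf_reachable z\<close> that assms(1) in auto)
    then show False using pair_degree_outside by simp
  qed
  with x assms(4) have x0: "pair_degree L x = 0" by blast
  obtain e z where z: "e \<in> L" "z \<in> e" using assms(3) pair by fastforce
  \<comment> \<open>Isolation spreads from \<open>x\<close> to every label, including the endpoint
    \<open>z\<close> of the pair \<open>e\<close>.\<close>
  have "pair_degree L z = 0"
  proof (rule near_auts_invariant_full[OF full, where P = "\<lambda>w. pair_degree L w = 0" and x = x])
    fix \<sigma> w assume *: "\<sigma> \<in> near_auts m L" "w \<in> {1..m}" "pair_degree L w = 0"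
    show "pair_degree L (\<sigma> w) = 0"
    proof (rule ccontr)
      assume "pair_degree L (\<sigma> w) \<noteq> 0"
      then have \<sigma>w: "\<sigma> w \<in> {1..n}" "leaf_reachable (\<sigma> w)"
        using label_if_pair_degree_pos pos by simp_all
      \<comment> \<open>x and w are both isolated, so \<open>\<sigma>\<close> may be replaced by a permutation moving x to \<open>\<sigma> w\<close>.\<close>
      have "(`) (\<sigma> \<circ> transpose x w) ` L = (`) \<sigma> ` L"
      proof -
        have "(`) (\<sigma> \<circ> transpose x w) ` L = (`) \<sigma> ` (`) (transpose x w) ` L"
          by (simp add: image_image comp_def)
        then show ?thesis by (simp only: transpose_isolated_image[OF x0 *(3)])
      qed
      then have "\<sigma> \<circ> transpose x w \<in> near_auts m L"
        using * assms(1,4) permutes_compose[OF permutes_swap_id, of x "{1..m}" w \<sigma>]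
        by (simp add: near_auts_def)
      with \<sigma>w x assms(4) show False
        using leaf_reachable_near_aut[of "\<sigma> \<circ> transpose x w" m x] by simp
    qed
  qed (use x0 z pair assms(1,4) in force)+
  with z show False by (simp add: pair_degree_eq_0)
qed

lemma full_if_leaf_reachable:
  assumes "n < m" and leaf: "\<And>x. x \<in> {1..n} \<Longrightarrow> leaf_reachable x"
  shows "near_aut_group m L = carrier (sym_group m)"
proof
  show "near_aut_group m L \<subseteq> carrier (sym_group m)"
    using near_aut_group_permutes by (auto simp: sym_group_carrier)
  have star: "transpose x (n + 1) \<in> near_aut_group m L" if x: "x \<in> {1..m}" for x
  proof (cases "x \<in> {1..n}")
    case True
    then obtain \<sigma> where \<sigma>: "\<sigma> \<in> near_aut_group n L" "pair_degree L (\<sigma> x) = 1"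
      using leaf by (auto simp: leaf_reachable_def)
    have perm: "\<sigma> permutes {1..n}" using near_aut_group_permutes[OF \<sigma>(1)] .
    have \<sigma>m: "\<sigma> \<in> near_aut_group m L" using \<sigma>(1) near_aut_group_mono[of m] assms(1) by auto
    have "\<sigma> x \<in> {1..m}" using permutes_in_image[OF near_aut_group_permutes[OF \<sigma>m]] x by blast
    then have "transpose (\<sigma> x) (n + 1) \<in> near_aut_group m L"
      using \<sigma>(2) assms(1) pair_degree_outside
      by (intro near_auts_in_group transpose_leaf_isolated) auto
    \<comment> \<open>As \<open>\<sigma>\<close> fixes \<open>n + 1\<close>, this conjugate is the
      transposition of \<open>x\<close> and \<open>n + 1\<close>.\<close>
    then have "inv' \<sigma> \<circ> (transpose (\<sigma> x) (n + 1) \<circ> \<sigma>) \<in> near_aut_group m L"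
      using \<sigma>m near_aut_group_comp near_aut_group_inv by blast
    moreover have "transpose (\<sigma> x) (n + 1) \<circ> \<sigma> = \<sigma> \<circ> transpose x (n + 1)"
    proof -
      have "inv' \<sigma> (n + 1) = n + 1"
        using permutes_not_in[OF permutes_inv[OF perm], of "n + 1"] by simp
      then show ?thesis
        using transpose_comp_eq[OF permutes_bij[OF perm]] permutes_inverses(2)[OF perm] by simp
    qed
    ultimately show ?thesis
      using permutes_inv_o(2)[OF perm] by (metis comp_assoc id_comp)
  next
    case False
    \<comment> \<open>Both labels are isolated here, so the transposition is an
      automorphism.\<close>
    then have "(`) (transpose x (n + 1)) ` L = L"
      using pair_degree_outside by (intro transpose_isolated_image) auto
    then show ?thesis
      using x assms(1) by (intro near_auts_in_group) (simp add: near_auts_def permutes_swap_id)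
  qed
  show "carrier (sym_group m) \<subseteq> near_aut_group m L"
    using permutes_in_star_closure[of _ "{1..m}" "n + 1" "near_aut_group m L"]
      near_aut_group_id near_aut_group_comp star assms(1)
    by (auto simp: sym_group_carrier)
qed

end

section \<open>Labelled graphs\<close>

text \<open>The order is a separate parameter so that the enlarged graph can be interpreted with
  order \<open>n + t\<close>.\<close>

locale labelled_graph =
  fixes G :: "'a ugraph" and v :: "nat \<Rightarrow> 'a" and n :: nat
  assumes simple: "simple_graph G" and order: "card (vertices G) = n" and lab: "labelling G v"
begin

abbreviation "L \<equiv> label_edges G v"

lemma bij_lab: "bij_betw v {1..n} (vertices G)"
  using lab order by (simp add: labelling_def)

lemma lab_image_eq_iff: "a \<subseteq> {1..n} \<Longrightarrow> b \<subseteq> {1..n} \<Longrightarrow> v ` a = v ` b \<longleftrightarrow> a = b"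
  using bij_lab by (meson bij_betw_def inj_on_image_eq_iff)

lemma edge_preimage:
  assumes "e \<in> edges G"
  obtains i j where "i \<in> {1..n}" "j \<in> {1..n}" "e = v ` {i, j}"
proof -
  have e: "e \<subseteq> v ` {1..n}" "card e = 2"
    using assms simple bij_lab by (auto simp: simple_graph_def bij_betw_def)
  then obtain x y where xy: "e = {x, y}" "x \<noteq> y" by (auto simp: card_2_iff)
  with e(1) obtain i j where "i \<in> {1..n}" "j \<in> {1..n}" "x = v i" "y = v j" by auto
  with xy that[of i j] show thesis by simp
qed

lemma label_edges_iff: "a \<in> L \<longleftrightarrow> a \<subseteq> {1..n} \<and> v ` a \<in> edges G"
proof
  assume "a \<in> L"
  then show "a \<subseteq> {1..n} \<and> v ` a \<in> edges G" by (auto simp: label_edges_def order)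
next
  assume a: "a \<subseteq> {1..n} \<and> v ` a \<in> edges G"
  then have "v ` a \<in> edges G" ..
  then obtain i j where ij: "i \<in> {1..n}" "j \<in> {1..n}" "v ` a = v ` {i, j}"
    by (rule edge_preimage)
  then have "a = {i, j}" using a lab_image_eq_iff[of a "{i, j}"] by simp
  with ij a show "a \<in> L" by (auto simp: label_edges_def order)
qed

lemma edges_eq: "edges G = (`) v ` L"
proof -
  have "e \<in> (`) v ` L" if "e \<in> edges G" for e
  proof -
    obtain i j where ij: "i \<in> {1..n}" "j \<in> {1..n}" "e = v ` {i, j}"
      using \<open>e \<in> edges G\<close> by (rule edge_preimage)
    with that have "{i, j} \<in> L" by (simp add: label_edges_iff)
    with ij(3) show ?thesis by blast
  qed
  then show ?thesis by (auto simp: label_edges_iff)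
qed

sublocale label_pairs n L
proof
  fix a assume "a \<in> L"
  then have a: "a \<subseteq> {1..n}" "v ` a \<in> edges G" by (auto simp: label_edges_iff)
  have "card (v ` a) = card a"
    using a(1) bij_lab by (meson bij_betw_def card_image inj_on_subset)
  with a simple show "a \<subseteq> {1..n} \<and> card a = 2" by (simp add: simple_graph_def)
qed

lemma label_edges_complement_iff:
  "b \<in> label_edges (graph_complement G) v \<longleftrightarrow> b \<subseteq> {1..n} \<and> card b = 2 \<and> b \<notin> L"
proof -
  have inj: "v i = v j \<longleftrightarrow> i = j" if "i \<in> {1..n}" "j \<in> {1..n}" for i j
    using that bij_lab by (metis bij_betw_def inj_on_eq_iff)
  have mem: "v i \<in> vertices G" if "i \<in> {1..n}" for i
    using that bij_lab bij_betwE by blast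
  have pairs: "{x, y} \<in> {{u, w} | u w. u \<in> V \<and> w \<in> V \<and> u \<noteq> w} \<longleftrightarrow> x \<noteq> y"
    if "x \<in> V" "y \<in> V" for x y :: 'a and V
    using that by (auto simp: doubleton_eq_iff)
  have *: "{v i, v j} \<in> edges (graph_complement G) \<longleftrightarrow> i \<noteq> j \<and> {i, j} \<notin> L"
    if "i \<in> {1..n}" "j \<in> {1..n}" for i j
    using pairs[OF mem mem, OF that] inj[OF that] that by (simp add: graph_complement_def label_edges_iff)
  have "vertices (graph_complement G) = vertices G"
    by (simp add: graph_complement_def)
  then have "b \<in> label_edges (graph_complement G) v \<longleftrightarrow>
      (\<exists>i j. b = {i, j} \<and> i \<in> {1..n} \<and> j \<in> {1..n} \<and> {v i, v j} \<in> edges (graph_complement G))"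
    unfolding label_edges_def by (simp only: order mem_Collect_eq)
  also have "\<dots> \<longleftrightarrow>
      (\<exists>i j. b = {i, j} \<and> i \<in> {1..n} \<and> j \<in> {1..n} \<and> i \<noteq> j \<and> {i, j} \<notin> L)"
    using * by (intro ex_cong1 conj_cong refl) simp_all
  also have "\<dots> \<longleftrightarrow> b \<subseteq> {1..n} \<and> card b = 2 \<and> b \<notin> L"
    by (auto simp: card_2_iff) blast
  finally show ?thesis .
qed

section \<open>Feasible replacements as near-automorphisms\<close>

lemma edges_relabel: "edges (relabel G v \<sigma>) = (`) v ` (`) (inv' \<sigma>) ` L"
proof -
  have *: "\<exists>i j. e = {i, j}" if "e \<in> L" for e
    using pair[OF that] by (auto simp: card_2_iff)
  then have "{{v (inv' \<sigma> i), v (inv' \<sigma> j)} | i j. {i, j} \<in> L} = (\<lambda>e. v ` inv' \<sigma> ` e) ` L"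
  proof (intro equalityI subsetI)
    fix f assume "f \<in> (\<lambda>e. v ` inv' \<sigma> ` e) ` L"
    then obtain e where e: "e \<in> L" "f = v ` inv' \<sigma> ` e" by blast
    with * obtain i j where "e = {i, j}" by blast
    with e show "f \<in> {{v (inv' \<sigma> i), v (inv' \<sigma> j)} | i j. {i, j} \<in> L}" by auto
  next
    fix f assume "f \<in> {{v (inv' \<sigma> i), v (inv' \<sigma> j)} | i j. {i, j} \<in> L}"
    then obtain i j where "{i, j} \<in> L" "f = v ` inv' \<sigma> ` {i, j}" by auto
    then show "f \<in> (\<lambda>e. v ` inv' \<sigma> ` e) ` L" by blast
  qed
  then show ?thesis by (simp add: relabel_def image_image)
qed

text \<open>Taking images under \<open>v\<close> is injective on subsets of \<open>{1..n}\<close>,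
  so equality of the graphs can be tested on label pairs.\<close>

lemma relabel_eq_edge_replace_iff:
  assumes "\<sigma> permutes {1..n}" "a \<in> L" "b \<subseteq> {1..n}"
  shows "relabel G v \<sigma> = edge_replace G (v ` a) (v ` b) \<longleftrightarrow>
    (`) (inv' \<sigma>) ` L = insert b (L - {a})"
proof -
  have inj: "inj_on ((`) v) (Pow {1..n})"
    using bij_lab by (auto simp: bij_betw_def intro: inj_on_image_Pow)
  have L: "L \<subseteq> Pow {1..n}" using pair by blast
  have "inv' \<sigma> ` {1..n} = {1..n}" using assms(1) by (simp add: permutes_inv permutes_image)
  then have L': "(`) (inv' \<sigma>) ` L \<subseteq> Pow {1..n}" using L by blast
  have "edges (edge_replace G (v ` a) (v ` b)) = (`) v ` insert b (L - {a})"
    using inj_on_image_set_diff[OF inj, of L "{a}"] L assms(2)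
    by (auto simp: edge_replace_def edges_eq)
  then have "relabel G v \<sigma> = edge_replace G (v ` a) (v ` b) \<longleftrightarrow>
      (`) v ` (`) (inv' \<sigma>) ` L = (`) v ` insert b (L - {a})"
    using edges_relabel[of \<sigma>]
    by (auto simp: relabel_def edge_replace_def)
  also have "\<dots> \<longleftrightarrow> (`) (inv' \<sigma>) ` L = insert b (L - {a})"
    using L assms(3) by (intro inj_on_image_eq_iff[OF inj L']) auto
  finally show ?thesis .
qed

text \<open>The isomorphism is \<open>\<sigma>\<close> transported to vertices by \<open>v\<close>.
  Consequently, feasibility is automatic for a replacement realised by a permutation.\<close>

lemma graph_iso_relabel:
  assumes "\<sigma> permutes {1..n}"
  shows "graph_iso (relabel G v \<sigma>) G"
proof -
  let ?u = "inv_into {1..n} v"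
  let ?f = "v \<circ> \<sigma> \<circ> ?u"
  have bu: "bij_betw ?u (vertices G) {1..n}" using bij_lab by (rule bij_betw_inv_into)
  then have "bij_betw ?f (vertices G) (vertices G)"
    using bij_lab permutes_imp_bij[OF assms] by (blast intro: bij_betw_trans)
  moreover have "{x, y} \<in> edges (relabel G v \<sigma>) \<longleftrightarrow> {?f x, ?f y} \<in> edges G"
    if xy: "x \<in> vertices G" "y \<in> vertices G" for x y
  proof -
    obtain i j where ij: "i \<in> {1..n}" "j \<in> {1..n}" "x = v i" "y = v j"
      using xy bij_lab unfolding bij_betw_def by blast
    have u: "?u x = i" "?u y = j"
      using ij bij_lab by (auto simp: bij_betw_def inv_into_f_f)
    have s: "\<sigma> i \<in> {1..n}" "\<sigma> j \<in> {1..n}"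
      using permutes_in_image[OF assms] ij by blast+
    have im: "inv' \<sigma> ` e \<subseteq> {1..n}" if "e \<in> L" for e
      using permutes_image[OF permutes_inv[OF assms]] pair[OF that] by blast
    have "{x, y} \<in> edges (relabel G v \<sigma>) \<longleftrightarrow> (\<exists>e\<in>L. v ` {i, j} = v ` inv' \<sigma> ` e)"
      using ij by (auto simp: edges_relabel)
    also have "\<dots> \<longleftrightarrow> (\<exists>e\<in>L. {i, j} = inv' \<sigma> ` e)"
      using ij im lab_image_eq_iff[of "{i, j}"] by (intro bex_cong) simp_all
    also have "\<dots> \<longleftrightarrow> \<sigma> ` {i, j} \<in> L"
    proof -
      have "{i, j} = inv' \<sigma> ` e \<longleftrightarrow> e = \<sigma> ` {i, j}" for e
        using permutes_inv_o[OF assms]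
        by (metis image_comp image_id id_apply)
      then show ?thesis by auto
    qed
    also have "\<dots> \<longleftrightarrow> {?f x, ?f y} \<in> edges G"
      using s u by (simp add: label_edges_iff)
    finally show ?thesis .
  qed
  ultimately show ?thesis
    unfolding graph_iso_def by (intro exI[of _ ?f]) (simp add: relabel_def)
qed

text \<open>Relabelling acts on pairs through the inverse of \<open>\<sigma>\<close>;
  \<open>card_diff_inv\<close> makes this harmless for the bound.\<close>

lemma all_replacement_perms_eq:
  assumes "edges G \<noteq> {}"
  shows "all_replacement_perms G v = near_auts n L"
proof (intro equalityI subsetI)
  fix \<sigma> assume "\<sigma> \<in> all_replacement_perms G v"
  then obtain a b where ab: "a \<in> L" "b \<in> label_edges (graph_complement G) v \<union> {a}"
    and \<sigma>: "\<sigma> permutes {1..n}" "relabel G v \<sigma> = edge_replace G (v ` a) (v ` b)"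
    by (auto simp: all_replacement_perms_def feasible_replacements_def replacement_perms_def
        sym_group_carrier order)
  have "b \<subseteq> {1..n}" using ab(2) pair[OF ab(1)] label_edges_complement_iff[of b] by blast
  with \<sigma> ab have "(`) (inv' \<sigma>) ` L = insert b (L - {a})"
    by (simp add: relabel_eq_edge_replace_iff)
  then have "(`) (inv' \<sigma>) ` L - L \<subseteq> {b}" by (simp only:) blast
  then have "card ((`) (inv' \<sigma>) ` L - L) \<le> card {b}" by (intro card_mono) auto
  with \<sigma>(1) show "\<sigma> \<in> near_auts n L" by (simp add: near_auts_def card_diff_inv)
next
  fix \<sigma> assume \<sigma>: "\<sigma> \<in> near_auts n L"
  then have perm: "\<sigma> permutes {1..n}" by (simp add: near_auts_def)
  let ?L = "(`) (inv' \<sigma>) ` L"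
  have perm': "inv' \<sigma> permutes {1..n}" using perm by (rule permutes_inv)
  have card_L: "card ?L = card L" using card_image_pairs[OF perm'] .
  have le: "card (?L - L) \<le> 1" using near_auts_inv[OF \<sigma>] by (simp add: near_auts_def)
  \<comment> \<open>Equal sizes mean that as many pairs are lost as gained, so one new pair
    \<open>b\<close> comes with exactly one lost pair \<open>a\<close>.\<close>
  have swap: "card (L - ?L) = card (?L - L)"
    using card_L finite_pairs by (metis card_le_sym_Diff finite_imageI le_antisym order_refl)
  obtain a b where ab: "a \<in> L" "b \<in> label_edges (graph_complement G) v \<union> {a}"
    "?L = insert b (L - {a})"
  proof (cases "card (?L - L) = 0")
    case True
    then have "?L \<subseteq> L" using finite_pairs by simp
    then have "?L = L" by (rule card_subset_eq[OF finite_pairs _ card_L])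
    \<comment> \<open>An automorphism is accounted for by a trivial replacement, which requires an
      edge to exist.\<close>
    moreover obtain a where "a \<in> L" using assms edges_eq by blast
    ultimately show thesis using that[of a a] by auto
  next
    case False
    with le have "card (?L - L) = 1" by simp
    with swap obtain a b where ab: "L - ?L = {a}" "?L - L = {b}"
      by (metis card_1_singletonE)
    have "b \<in> ?L - L" by (simp only: ab(2) singletonI)
    then obtain e where e: "e \<in> L" "b = inv' \<sigma> ` e" by (elim DiffE imageE)
    have "b \<subseteq> {1..n}"
      using conjunct1[OF pair[OF e(1)]] e(2) permutes_image[OF perm'] by (metis image_mono)
    moreover have "card b = 2"
      using pair[OF e(1)] e(2) card_image[of "inv' \<sigma>" e] permutes_inj_on[OF perm'] by simp
    ultimately have "b \<in> label_edges (graph_complement G) v"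
      using \<open>b \<in> ?L - L\<close> by (simp add: label_edges_complement_iff)
    moreover have swap_eq: "a \<in> L \<and> M = insert b (L - {a})" if "L - M = {a}" "M - L = {b}" for M
      using that by blast
    ultimately show thesis using swap_eq[OF ab] by (intro that[of a b]) simp_all
  qed
  have "b \<subseteq> {1..n}" using ab(2) pair[OF ab(1)] label_edges_complement_iff[of b] by blast
  then have rel: "relabel G v \<sigma> = edge_replace G (v ` a) (v ` b)"
    using ab(3) by (simp only: relabel_eq_edge_replace_iff[OF perm ab(1)])
  then have "graph_iso (edge_replace G (v ` a) (v ` b)) G"
    using graph_iso_relabel[OF perm] by simp
  then have "(a, b) \<in> feasible_replacements G v"
    using ab(1,2) by (simp add: feasible_replacements_def)
  moreover have "\<sigma> \<in> replacement_perms G v a b"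
    using rel perm by (simp add: replacement_perms_def sym_group_carrier order)
  ultimately show "\<sigma> \<in> all_replacement_perms G v"
    unfolding all_replacement_perms_def by blast
qed

lemma amoeba_group_eq: "edges G \<noteq> {} \<Longrightarrow> amoeba_group G v = near_aut_group n L"
  by (simp add: amoeba_group_def near_aut_group_def all_replacement_perms_eq order)

lemma degree_eq:
  assumes "i \<in> {1..n}" shows "degree G (v i) = pair_degree L i"
proof -
  have mem: "v i \<in> v ` a \<longleftrightarrow> i \<in> a" if "a \<in> L" for a
    using that assms bij_lab pair by (meson bij_betw_def inj_on_image_mem_iff)
  have "{e \<in> edges G. v i \<in> e} = (`) v ` {a \<in> L. i \<in> a}"
    using mem by (auto simp: edges_eq)
  moreover have "inj_on ((`) v) {a \<in> L. i \<in> a}"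
    using lab_image_eq_iff pair by (auto simp: inj_on_def)
  ultimately show ?thesis
    by (simp add: degree_def pair_degree_def card_image)
qed

section \<open>Isolated vertices and the three conditions\<close>

lemma leaf_in_orbit_iff:
  assumes "edges G \<noteq> {}" "x \<in> {1..n}"
  shows "(\<exists>y \<in> amoeba_orbit G v x. degree G (v y) = 1) \<longleftrightarrow> leaf_reachable x"
proof -
  have "degree G (v (\<sigma> x)) = pair_degree L (\<sigma> x)" if "\<sigma> \<in> near_aut_group n L" for \<sigma>
    using degree_eq permutes_in_image[OF near_aut_group_permutes[OF that]] assms(2) by blast
  then show ?thesis
    using assms(1) by (auto simp: amoeba_orbit_def leaf_reachable_def amoeba_group_eq)
qed

text \<open>The added labels name vertices \<open>Inr i\<close>, whereas every edge consists of
  \<open>Inl\<close> vertices.\<close>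

lemma label_edges_add_isolated: "label_edges (add_isolated G t) (extend_labelling G v) = L"
proof -
  interpret H: labelled_graph "add_isolated G t" "extend_labelling G v" "n + t"
    by unfold_locales
      (simp_all add: simple simple_graph_add_isolated card_vertices_add_isolated order lab
        labelling_extend_labelling)
  have edges: "edges (add_isolated G t) = (`) Inl ` edges G"
    by (simp add: add_isolated_def disjoint_union_def edgeless_graph_def)
  have ext: "extend_labelling G v ` a = Inl ` v ` a" if "a \<subseteq> {1..n}" for a
    unfolding image_image using that by (intro image_cong) (auto simp: extend_labelling_def order)
  show ?thesis
  proof (intro equalityI subsetI)
    fix a assume "a \<in> H.L"
    then have a: "a \<subseteq> {1..n + t}" "extend_labelling G v ` a \<in> (`) Inl ` edges G"
      using H.label_edges_iff edges by auto
    then have "\<forall>i\<in>a. \<exists>w. extend_labelling G v i = Inl w" by blast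
    then have "a \<subseteq> {1..n}" using a(1) by (fastforce simp: extend_labelling_def order split: if_splits)
    with a ext show "a \<in> L" by (auto simp: label_edges_iff inj_image_eq_iff)
  next
    fix a assume "a \<in> L"
    then show "a \<in> H.L" unfolding label_edges_iff H.label_edges_iff edges
      using ext by fastforce
  qed
qed

lemma local_amoeba_add_isolated_iff:
  assumes "edges G \<noteq> {}"
  shows "local_amoeba (add_isolated G t) (extend_labelling G v) \<longleftrightarrow>
    near_aut_group (n + t) L = carrier (sym_group (n + t))"
proof -
  interpret H: labelled_graph "add_isolated G t" "extend_labelling G v" "n + t"
    by unfold_locales
      (simp_all add: simple simple_graph_add_isolated card_vertices_add_isolated order lab
        labelling_extend_labelling)
  have "edges (add_isolated G t) \<noteq> {}"
    using assms by (simp add: add_isolated_def disjoint_union_def)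
  then show ?thesis
    by (simp add: local_amoeba_def H.amoeba_group_eq label_edges_add_isolated H.order)
qed

text \<open>The right-hand side does not depend on \<open>t\<close>: one isolated vertex is as good
  as any larger number, which yields all the equivalences at once.\<close>

lemma local_amoeba_iff_leaf_reachable:
  assumes "edges G \<noteq> {}" "t > 0"
  shows "local_amoeba (add_isolated G t) (extend_labelling G v) \<longleftrightarrow>
    (\<forall>x \<in> {1..n}. \<exists>y \<in> amoeba_orbit G v x. degree G (v y) = 1)"
proof -
  have "L \<noteq> {}" using assms(1) edges_eq by blast
  then have "near_aut_group (n + t) L = carrier (sym_group (n + t)) \<longleftrightarrow> (\<forall>x \<in> {1..n}. leaf_reachable x)"
    using leaf_reachable_if_full[of "n + t"] full_if_leaf_reachable[of "n + t"] assms(2)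
    by (metis less_add_same_cancel1)
  also have "\<dots> \<longleftrightarrow> (\<forall>x \<in> {1..n}. \<exists>y \<in> amoeba_orbit G v x. degree G (v y) = 1)"
    using leaf_in_orbit_iff[OF assms(1)] by (intro ball_cong refl) blast
  finally show ?thesis
    by (simp only: local_amoeba_add_isolated_iff[OF assms(1)])
qed

end

theorem theorem3p8:
  fixes G :: "'a ugraph" and v :: "nat \<Rightarrow> 'a" and n :: nat
  assumes "simple_graph G"
    and "card (vertices G) = n"
    and "labelling G v"
    and "edges G \<noteq> {}"
  shows "(global_amoeba G v \<longleftrightarrow>
            (\<forall>x \<in> {1..n}. \<exists>y \<in> amoeba_orbit G v x. degree G (v y) = 1)) \<and>
         ((\<forall>x \<in> {1..n}. \<exists>y \<in> amoeba_orbit G v x. degree G (v y) = 1) \<longleftrightarrow>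
            local_amoeba (add_isolated G 1) (extend_labelling G v))"
proof -
  interpret labelled_graph G v n
    using assms by unfold_locales
  note iff = local_amoeba_iff_leaf_reachable[OF assms(4)]
  have "global_amoeba G v \<longleftrightarrow>
      (\<forall>x \<in> {1..n}. \<exists>y \<in> amoeba_orbit G v x. degree G (v y) = 1)"
  proof
    assume "global_amoeba G v"
    \<comment> \<open>The successor is taken because the criterion needs at least one isolated
      vertex, and the threshold may be 0.\<close>
    then obtain T where "local_amoeba (add_isolated G (Suc T)) (extend_labelling G v)"
      unfolding global_amoeba_def by (meson le_SucI order_refl)
    with iff[of "Suc T"] show "\<forall>x \<in> {1..n}. \<exists>y \<in> amoeba_orbit G v x. degree G (v y) = 1" by simp
  next
    assume "\<forall>x \<in> {1..n}. \<exists>y \<in> amoeba_orbit G v x. degree G (v y) = 1"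
    with iff show "global_amoeba G v"
      unfolding global_amoeba_def by (intro exI[of _ 1]) auto
  qed
  with iff[of 1] show ?thesis by simp
qed

end
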